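(* Assume that the risk-sensitive constrained problem $$(\mathrm P)\quad \sup_{\Pi\in\Gamma} J_r(\Pi,\alpha_r)\quad\text{subject to}\quad J_c(\Pi,\alpha_c)\le B$$ has a solution. Let $\mathbb M=\{\Pi\in\Gamma:\Pi\in\mathcal M(\Pi)\}$. Then problem $(\mathrm P)$ is equivalent to each of the following two problems, in the sense that the set of solutions (maximizers) of $(\mathrm P)$ coincides with the set of solutions of each of them: $$\mathbf{GF}:\quad \sup_{\Pi\in\mathbb M}\ \sum_{t=1}^{T-1} f_t(\Pi,\Theta^{\Pi}_r,\mathbb Q^{\Pi}_r);$$ $$\mathbf{GO}:\quad \sup_{\Pi\in\Gamma}\ \sum_{t=1}^{T-1} f_t(\Pi,\Theta^{\Pi}_r,\mathbb Q^{\Pi}_r)\quad\text{subject to}\quad f_t(\Pi,\Theta^{\Pi}_c,\mathbb Q^{\Pi}_c)\le B\ \text{ for all } t\le T-1 .$$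
   Context: Setting. $T<\infty$ is the horizon ($T\ge 2$). For $1\le t\le T$, $\mathcal S_t$ is a finite nonempty state space; for $1\le t\le T-1$ and $x\in\mathcal S_t$, $\mathcal A_{t,x}$ is a finite nonempty action set; $p_t(x'|x,a)$ is the probability of moving to $x'\in\mathcal S_{t+1}$ from $x\in\mathcal S_t$ under action $a\in\mathcal A_{t,x}$. A (Markovian randomized) policy is $\Pi=(d_1,\dots,d_{T-1})$, where for each $t$ and $x\in\mathcal S_t$, $d_t(x,\cdot)$ is a probability distribution on $\mathcal A_{t,x}$; $\Gamma$ is the set of all such policies. Given real functions $\tilde r_t(x,a,x')$, $\tilde c_t(x,a,x')$ ($t\le T-1$) and $\tilde r_T(x)$, $\tilde c_T(x)$, risk factors $\gamma,\gamma_c\in\mathbb R$ and discount factors $\beta,\beta_c\in(0,1)$, set $r_t=\gamma\beta^t\tilde r_t$ and $c_t=\gamma_c\beta_c^t\tilde c_t$ for $1\le t\le T$. $\alpha_r,\alpha_c$ are probability distributions on $\mathcal S_1$ and $B\in\mathbb R$. For $m\in\{r,c\}$, $$J_m(\Pi,\alpha_m)=E^{\Pi}_{\alpha_m}\Big[e^{\sum_{t=1}^{T-1} m_t(X_t,A_t,X_{t+1})+m_T(X_T)}\Big],$$ where $(X_t,A_t)$ is the state-action process under $\Pi$ with $X_1\sim\alpha_m$. Forward factors: for $1\le t\le T$, $x\in\mathcal S_t$, $$\theta^{\Pi}_{m,t}(x)=E^{\Pi}_{\alpha_m}\Big[e^{\sum_{k=1}^{t-1}m_k(X_k,A_k,X_{k+1})}\mathbf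 1_{\{X_t=x\}}\Big].$$ Backward factors: for $1\le t\le T-1$, $x\in\mathcal S_t$, $a\in\mathcal A_{t,x}$, $$Q^{\Pi}_{m,t}(x,a)=E^{\Pi}\Big[e^{\sum_{\tau=t}^{T-1}m_\tau(X_\tau,A_\tau,X_{\tau+1})+m_T(X_T)}\,\Big|\,X_t=x,A_t=a\Big],$$ computed for the process started at time $t$ in state $x$ with action $a$ and with $\Pi$ used from time $t+1$ onwards. Write $\Theta^{\Pi}_m=(\theta^{\Pi}_{m,t}(x))_{t,x}$ and $\mathbb Q^{\Pi}_m=(Q^{\Pi}_{m,t}(x,a))_{t,x,a}$. For policies $\Pi$ and $\tilde\Pi=(\tilde d_1,\dots,\tilde d_{T-1})$ and $t\le T-1$, $$f_t(\tilde\Pi,\Theta^{\Pi}_m,\mathbb Q^{\Pi}_m)=\sum_{x\in\mathcal S_t}\sum_{a\in\mathcal A_{t,x}}\theta^{\Pi}_{m,t}(x)\,\tilde d_t(x,a)\,Q^{\Pi}_{m,t}(x,a).$$ For $\Pi\in\Gamma$, $\mathcal M(\Pi)\subseteq\Gamma$ denotes the set of maximizers of the linear program $$\mathrm{LP}(\Pi):\quad \max_{\tilde\Pi\in\Gamma}\ \sum_{t=1}^{T-1} f_t(\tilde\Pi,\Theta^{\Pi}_r,\mathbb Q^{\Pi}_r)\quad\text{subject to}\quad f_t(\tilde\Pi,\Theta^{\Pi}_c,\mathbb Q^{\Pi}_c)\le B\ \text{ for all } 1\le t<T .$$ *)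

theory Defs
  imports "HOL-Probability.Probability_Mass_Function"
begin

(* A criterion (reward or cost) on trajectories: stage terms m_t(x, a, x') for 1 <= t < T
   and a terminal term m_T(x). *)
record ('s, 'a) criterion =
  running :: "nat \<Rightarrow> 's \<Rightarrow> 'a \<Rightarrow> 's \<Rightarrow> real"
  terminal :: "'s \<Rightarrow> real"

(* Time-dependent state spaces and state-dependent action sets are subsets of common types.
   raw_reward and raw_cost are the functions before discounting and scaling by the risk factors. *)
record ('s, 'a) rs_cmdp =
  horizon :: nat
  states :: "nat \<Rightarrow> 's set"
  actions :: "nat \<Rightarrow> 's \<Rightarrow> 'a set"
  trans_prob :: "nat \<Rightarrow> 's \<Rightarrow> 'a \<Rightarrow> 's pmf"
  raw_reward :: "('s, 'a) criterion"
  raw_cost :: "('s, 'a) criterion"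
  risk_reward :: real
  risk_cost :: real
  disc_reward :: real
  disc_cost :: real
  init_reward :: "'s pmf"
  init_cost :: "'s pmf"
  budget :: real

definition wf_cmdp :: "('s, 'a) rs_cmdp \<Rightarrow> bool" where
  "wf_cmdp M \<longleftrightarrow>
     2 \<le> horizon M \<and>
     (\<forall>t\<in>{1..horizon M}. finite (states M t) \<and> states M t \<noteq> {}) \<and>
     (\<forall>t\<in>{1..<horizon M}. \<forall>x\<in>states M t. finite (actions M t x) \<and> actions M t x \<noteq> {}) \<and>
     (\<forall>t\<in>{1..<horizon M}. \<forall>x\<in>states M t. \<forall>a\<in>actions M t x.
        set_pmf (trans_prob M t x a) \<subseteq> states M (Suc t)) \<and>
     0 < disc_reward M \<and> disc_reward M < 1 \<and>
     0 < disc_cost M \<and> disc_cost M < 1 \<and>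
     set_pmf (init_reward M) \<subseteq> states M 1 \<and>
     set_pmf (init_cost M) \<subseteq> states M 1"

definition scaled :: "nat \<Rightarrow> real \<Rightarrow> real \<Rightarrow> ('s, 'a) criterion \<Rightarrow> ('s, 'a) criterion" where
  "scaled T \<gamma> \<beta> m =
     \<lparr> running = (\<lambda>t x a x'. \<gamma> * \<beta> ^ t * running m t x a x'),
       terminal = (\<lambda>x. \<gamma> * \<beta> ^ T * terminal m x) \<rparr>"

definition reward :: "('s, 'a) rs_cmdp \<Rightarrow> ('s, 'a) criterion" where
  "reward M = scaled (horizon M) (risk_reward M) (disc_reward M) (raw_reward M)"

definition cost :: "('s, 'a) rs_cmdp \<Rightarrow> ('s, 'a) criterion" where
  "cost M = scaled (horizon M) (risk_cost M) (disc_cost M) (raw_cost M)"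

type_synonym ('s, 'a) policy = "nat \<Rightarrow> 's \<Rightarrow> 'a pmf"

(* Extensional products: a policy carries no information outside 1 <= t < T, x in S_t. *)
definition policies :: "('s, 'a) rs_cmdp \<Rightarrow> ('s, 'a) policy set" where
  "policies M =
     (\<Pi>\<^sub>E t\<in>{1..<horizon M}. \<Pi>\<^sub>E x\<in>states M t. {q. set_pmf q \<subseteq> actions M t x})"

(* A trajectory is the pair of the state sequence X and the action sequence A. *)
type_synonym ('s, 'a) traj = "(nat \<Rightarrow> 's) \<times> (nat \<Rightarrow> 'a)"

definition move :: "('s, 'a) rs_cmdp \<Rightarrow> nat \<Rightarrow> 'a \<Rightarrow> ('s, 'a) traj \<Rightarrow> ('s, 'a) traj pmf" where
  "move M t a = (\<lambda>(X, A).
     map_pmf (\<lambda>x'. (X(Suc t := x'), A(t := a))) (trans_prob M t (X t) a))"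

(* Run n steps under the policy, starting at time t from the state recorded in the trajectory. *)
primrec run :: "('s, 'a) rs_cmdp \<Rightarrow> ('s, 'a) policy \<Rightarrow> nat \<Rightarrow> nat \<Rightarrow> ('s, 'a) traj \<Rightarrow> ('s, 'a) traj pmf" where
  "run M d t 0 \<omega> = return_pmf \<omega>"
| "run M d t (Suc n) \<omega> =
     bind_pmf (d t (fst \<omega> t)) (\<lambda>a. bind_pmf (move M t a \<omega>) (run M d (Suc t) n))"

(* Entries outside the relevant time range are undefined and never used. *)
definition start :: "nat \<Rightarrow> 's \<Rightarrow> ('s, 'a) traj" where
  "start t x = ((\<lambda>_. undefined)(t := x), \<lambda>_. undefined)"

definition law :: "('s, 'a) rs_cmdp \<Rightarrow> ('s, 'a) policy \<Rightarrow> 's pmf \<Rightarrow> ('s, 'a) traj pmf" where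
  "law M d \<alpha> = bind_pmf \<alpha> (\<lambda>x. run M d 1 (horizon M - 1) (start 1 x))"

(* Law of the process started at time t in state x with action a, using d from time t + 1 on. *)
definition law_from :: "('s, 'a) rs_cmdp \<Rightarrow> ('s, 'a) policy \<Rightarrow> nat \<Rightarrow> 's \<Rightarrow> 'a \<Rightarrow> ('s, 'a) traj pmf" where
  "law_from M d t x a =
     bind_pmf (move M t a (start t x)) (run M d (Suc t) (horizon M - Suc t))"

definition partial_sum :: "('s, 'a) criterion \<Rightarrow> nat \<Rightarrow> nat \<Rightarrow> ('s, 'a) traj \<Rightarrow> real" where
  "partial_sum m t u = (\<lambda>(X, A). \<Sum>k\<in>{t..<u}. running m k (X k) (A k) (X (Suc k)))"

definition J :: "('s, 'a) rs_cmdp \<Rightarrow> ('s, 'a) criterion \<Rightarrow> 's pmf \<Rightarrow> ('s, 'a) policy \<Rightarrow> real" where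
  "J M m \<alpha> d = measure_pmf.expectation (law M d \<alpha>)
     (\<lambda>\<omega>. exp (partial_sum m 1 (horizon M) \<omega> + terminal m (fst \<omega> (horizon M))))"

definition forward_factor ::
  "('s, 'a) rs_cmdp \<Rightarrow> ('s, 'a) criterion \<Rightarrow> 's pmf \<Rightarrow> ('s, 'a) policy \<Rightarrow> nat \<Rightarrow> 's \<Rightarrow> real" where
  "forward_factor M m \<alpha> d t x = measure_pmf.expectation (law M d \<alpha>)
     (\<lambda>\<omega>. exp (partial_sum m 1 t \<omega>) * of_bool (fst \<omega> t = x))"

definition backward_factor ::
  "('s, 'a) rs_cmdp \<Rightarrow> ('s, 'a) criterion \<Rightarrow> ('s, 'a) policy \<Rightarrow> nat \<Rightarrow> 's \<Rightarrow> 'a \<Rightarrow> real" where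
  "backward_factor M m d t x a = measure_pmf.expectation (law_from M d t x a)
     (\<lambda>\<omega>. exp (partial_sum m t (horizon M) \<omega> + terminal m (fst \<omega> (horizon M))))"

definition stage_value :: "('s, 'a) rs_cmdp \<Rightarrow> nat \<Rightarrow> ('s, 'a) policy \<Rightarrow>
    (nat \<Rightarrow> 's \<Rightarrow> real) \<Rightarrow> (nat \<Rightarrow> 's \<Rightarrow> 'a \<Rightarrow> real) \<Rightarrow> real" where
  "stage_value M t d \<Theta> Q = (\<Sum>x\<in>states M t. \<Sum>a\<in>actions M t x. \<Theta> t x * pmf (d t x) a * Q t x a)"

(* f_reward M t d' d is f_t(d', Theta_r^d, Q_r^d): factors of d, decision rule of d'. *)
definition f_reward :: "('s, 'a) rs_cmdp \<Rightarrow> nat \<Rightarrow> ('s, 'a) policy \<Rightarrow> ('s, 'a) policy \<Rightarrow> real" where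
  "f_reward M t d' d =
     stage_value M t d' (forward_factor M (reward M) (init_reward M) d) (backward_factor M (reward M) d)"

definition f_cost :: "('s, 'a) rs_cmdp \<Rightarrow> nat \<Rightarrow> ('s, 'a) policy \<Rightarrow> ('s, 'a) policy \<Rightarrow> real" where
  "f_cost M t d' d =
     stage_value M t d' (forward_factor M (cost M) (init_cost M) d) (backward_factor M (cost M) d)"

definition solutions_LP :: "('s, 'a) rs_cmdp \<Rightarrow> ('s, 'a) policy \<Rightarrow> ('s, 'a) policy set" where
  "solutions_LP M d = {d'. is_arg_max
     (\<lambda>e. \<Sum>t\<in>{1..<horizon M}. f_reward M t e d)
     (\<lambda>e. e \<in> policies M \<and> (\<forall>t\<in>{1..<horizon M}. f_cost M t e d \<le> budget M)) d'}"

definition fixed_points :: "('s, 'a) rs_cmdp \<Rightarrow> ('s, 'a) policy set" where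
  "fixed_points M = {d \<in> policies M. d \<in> solutions_LP M d}"

definition solutions_P :: "('s, 'a) rs_cmdp \<Rightarrow> ('s, 'a) policy set" where
  "solutions_P M = {d. is_arg_max
     (J M (reward M) (init_reward M))
     (\<lambda>e. e \<in> policies M \<and> J M (cost M) (init_cost M) e \<le> budget M) d}"

definition solutions_GF :: "('s, 'a) rs_cmdp \<Rightarrow> ('s, 'a) policy set" where
  "solutions_GF M = {d. is_arg_max
     (\<lambda>e. \<Sum>t\<in>{1..<horizon M}. f_reward M t e e)
     (\<lambda>e. e \<in> fixed_points M) d}"

definition solutions_GO :: "('s, 'a) rs_cmdp \<Rightarrow> ('s, 'a) policy set" where
  "solutions_GO M = {d. is_arg_max
     (\<lambda>e. \<Sum>t\<in>{1..<horizon M}. f_reward M t e e)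
     (\<lambda>e. e \<in> policies M \<and> (\<forall>t\<in>{1..<horizon M}. f_cost M t e e \<le> budget M)) d}"

end

theory Submission
  imports Defs
begin

text \<open>
  The factorization behind the theorem is \<open>f\<^sub>t(d', \<Theta>\<^sup>d, Q\<^sup>d) = J(d(t := d' t))\<close>: cutting a trajectory
  at time \<open>t\<close> splits the exponential of the total criterion into a factor determined by the past
  and a factor determined by the future. By the Markov property the conditional expectation of the
  latter depends on the past only through the state at time \<open>t\<close>
  (lemma \<open>expectation_tail\<close>). Moreover the forward factor involves only the decision rules
  before \<open>t\<close> and the backward factor only those after \<open>t\<close>, so both remain the same when the rule at
  stage \<open>t\<close> is exchanged (lemma \<open>stage_value_eq_J_upd\<close>).

  With \<open>d' = d\<close>, every stage value of \<open>d\<close> equals \<open>J d\<close>. Hence \<open>GO\<close> has the feasible set of \<open>P\<close> and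
  \<open>T - 1\<close> times its objective. For \<open>GF\<close>, a fixed point is feasible for its own linear
  program, hence for \<open>P\<close>. Conversely, let \<open>d\<close> solve \<open>P\<close>. If \<open>d'\<close> is feasible for the linear program
  of \<open>d\<close>, then each of the policies \<open>d(t := d' t)\<close> is feasible for \<open>P\<close>, so its reward is at most that
  of \<open>d\<close>; adding up over \<open>t\<close> shows that \<open>d\<close> solves its own linear program. Thus the feasible
  set of \<open>GF\<close> lies between the set of solutions and the feasible set of \<open>P\<close>, and as soon as a solution
  exists the maximizers agree.
\<close>

(* Stages are counted from 1; rewriting this 1 to Suc 0 would keep goals from matching the lemmas. *)
declare One_nat_def [simp del]

section \<open>Trajectories generated by a policy\<close>

lemma expectation_bind_pmf_finite:
  fixes h :: "'b \<Rightarrow> real"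
  assumes "finite (set_pmf p)" "\<And>x. x \<in> set_pmf p \<Longrightarrow> finite (set_pmf (f x))"
  shows "measure_pmf.expectation (bind_pmf p f) h =
         measure_pmf.expectation p (\<lambda>x. measure_pmf.expectation (f x) h)"
proof -
  have "measure_pmf.expectation (bind_pmf p f) h =
        (\<Sum>a\<in>set_pmf p. pmf p a *\<^sub>R measure_pmf.expectation (f a) h)"
    by (intro pmf_expectation_bind assms order_refl)
  also have "\<dots> = measure_pmf.expectation p (\<lambda>x. measure_pmf.expectation (f x) h)"
    by (rule integral_measure_pmf[symmetric]) (auto simp: assms)
  finally show ?thesis .
qed

lemma run_add: "run M d t (n + k) \<omega> = bind_pmf (run M d t n \<omega>) (run M d (t + n) k)"
proof (induction n arbitrary: t \<omega>)
  case (Suc n)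
  then have "run M d t (n + k) = (\<lambda>\<omega>. bind_pmf (run M d t n \<omega>) (run M d (t + n) k))" for t
    by (intro ext)
  then show ?case
    by (simp add: bind_assoc_pmf)
qed (simp add: bind_return_pmf)

lemma run_cong:
  assumes "\<And>k. t \<le> k \<Longrightarrow> k < t + n \<Longrightarrow> d k = e k"
  shows "run M d t n \<omega> = run M e t n \<omega>"
  using assms
proof (induction n arbitrary: t \<omega>)
  case (Suc n)
  have "run M d (Suc t) n = run M e (Suc t) n"
    by (intro ext Suc.IH Suc.prems) auto
  moreover have "d t = e t"
    by (rule Suc.prems) auto
  ultimately show ?case
    by simp
qed simp

lemma run_keeps_past:
  assumes "\<omega>' \<in> set_pmf (run M d t n \<omega>)"
  shows "(\<forall>k\<le>t. fst \<omega>' k = fst \<omega> k) \<and> (\<forall>k<t. snd \<omega>' k = snd \<omega> k)"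
  using assms
proof (induction n arbitrary: t \<omega>)
  case (Suc n)
  from Suc.prems obtain a \<omega>1 where
    *: "\<omega>1 \<in> set_pmf (move M t a \<omega>)" "\<omega>' \<in> set_pmf (run M d (Suc t) n \<omega>1)"
    by auto
  show ?case
    using * Suc.IH[OF *(2)] by (auto simp: move_def split: prod.splits)
qed simp

text \<open>The histories of two trajectories before time \<open>s\<close> may differ. An observable that ignores them
  has the same law under the two runs, since each step looks only at the current
  state. The induction shifts \<open>t\<close> but keeps \<open>s\<close>, because the observable also sees the part of the
  run that has already been generated.\<close>

lemma map_run_independent_of_past:
  assumes "s \<le> t"
    and "\<And>k. s \<le> k \<Longrightarrow> k \<le> t \<Longrightarrow> fst \<omega>1 k = fst \<omega>2 k"
    and "\<And>k. s \<le> k \<Longrightarrow> k < t \<Longrightarrow> snd \<omega>1 k = snd \<omega>2 k"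
    and "\<And>\<omega> \<omega>'. (\<And>k. s \<le> k \<Longrightarrow> k \<le> t + n \<Longrightarrow> fst \<omega> k = fst \<omega>' k) \<Longrightarrow>
           (\<And>k. s \<le> k \<Longrightarrow> k < t + n \<Longrightarrow> snd \<omega> k = snd \<omega>' k) \<Longrightarrow> h \<omega> = h \<omega>'"
  shows "map_pmf h (run M d t n \<omega>1) = map_pmf h (run M d t n \<omega>2)"
  using assms
proof (induction n arbitrary: t \<omega>1 \<omega>2)
  case 0
  have "h \<omega>1 = h \<omega>2"
    by (rule 0(4)) (use 0(2,3) in simp_all)
  then show ?case by simp
next
  case (Suc n)
  have x: "fst \<omega>1 t = fst \<omega>2 t"
    using Suc.prems(1,2) by simp
  have step: "map_pmf h (run M d (Suc t) n ((fst \<omega>1)(Suc t := y), (snd \<omega>1)(t := a))) =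
        map_pmf h (run M d (Suc t) n ((fst \<omega>2)(Suc t := y), (snd \<omega>2)(t := a)))" for a y
  proof (rule Suc.IH)
    show "h \<omega> = h \<omega>'"
      if "\<And>k. s \<le> k \<Longrightarrow> k \<le> Suc t + n \<Longrightarrow> fst \<omega> k = fst \<omega>' k"
        "\<And>k. s \<le> k \<Longrightarrow> k < Suc t + n \<Longrightarrow> snd \<omega> k = snd \<omega>' k" for \<omega> \<omega>'
      by (rule Suc.prems(4)) (use that in auto)
  qed (use Suc.prems(1) in \<open>simp_all add: Suc.prems(2,3)\<close>)
  have "map_pmf h (bind_pmf (move M t a \<omega>1) (run M d (Suc t) n)) =
        map_pmf h (bind_pmf (move M t a \<omega>2) (run M d (Suc t) n))" for a
    by (cases \<omega>1; cases \<omega>2)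
       (use step[of _ a] x in \<open>simp add: move_def bind_map_pmf map_bind_pmf\<close>)
  then show ?case
    by (simp add: map_bind_pmf x)
qed

lemma finite_set_move:
  assumes "wf_cmdp M" "t \<in> {1..<horizon M}" "fst \<omega> t \<in> states M t" "a \<in> actions M t (fst \<omega> t)"
  shows "finite (set_pmf (move M t a \<omega>)) \<and>
         (\<forall>\<omega>'\<in>set_pmf (move M t a \<omega>). fst \<omega>' (Suc t) \<in> states M (Suc t))"
proof -
  have "set_pmf (trans_prob M t (fst \<omega> t) a) \<subseteq> states M (Suc t)" "finite (states M (Suc t))"
    using assms unfolding wf_cmdp_def by auto
  then show ?thesis
    by (cases \<omega>) (auto simp: move_def dest: finite_subset)
qed

lemma policies_action:
  assumes "d \<in> policies M" "t \<in> {1..<horizon M}" "x \<in> states M t"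
  shows "set_pmf (d t x) \<subseteq> actions M t x"
proof -
  have "d t x \<in> {q. set_pmf q \<subseteq> actions M t x}"
    using PiE_mem[OF PiE_mem[OF assms(1)[unfolded policies_def] assms(2)] assms(3)] .
  then show ?thesis
    by simp
qed

lemma finite_set_run:
  assumes "wf_cmdp M" "d \<in> policies M" "1 \<le> t" "t + n \<le> horizon M" "fst \<omega> t \<in> states M t"
  shows "finite (set_pmf (run M d t n \<omega>)) \<and>
         (\<forall>\<omega>'\<in>set_pmf (run M d t n \<omega>). fst \<omega>' (t + n) \<in> states M (t + n))"
  using assms(3-5)
proof (induction n arbitrary: t \<omega>)
  case (Suc n)
  have t: "t \<in> {1..<horizon M}"
    using Suc.prems by auto
  have sub: "set_pmf (d t (fst \<omega> t)) \<subseteq> actions M t (fst \<omega> t)"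
    by (rule policies_action[OF assms(2) t Suc.prems(3)])
  moreover have "finite (actions M t (fst \<omega> t))"
    using assms(1) t Suc.prems(3) unfolding wf_cmdp_def by auto
  ultimately have fin: "finite (set_pmf (d t (fst \<omega> t)))"
    by (rule finite_subset)
  have mv: "finite (set_pmf (move M t a \<omega>)) \<and>
         (\<forall>\<omega>'\<in>set_pmf (move M t a \<omega>). fst \<omega>' (Suc t) \<in> states M (Suc t))"
    if "a \<in> set_pmf (d t (fst \<omega> t))" for a
    using finite_set_move[OF assms(1) t Suc.prems(3)] that sub by blast
  have IH: "finite (set_pmf (run M d (Suc t) n \<omega>1)) \<and>
         (\<forall>\<omega>'\<in>set_pmf (run M d (Suc t) n \<omega>1). fst \<omega>' (Suc t + n) \<in> states M (Suc t + n))"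
    if "a \<in> set_pmf (d t (fst \<omega> t))" "\<omega>1 \<in> set_pmf (move M t a \<omega>)" for a \<omega>1
    by (rule Suc.IH) (use Suc.prems mv that in auto)
  show ?case
    using fin mv IH by auto
qed simp

section \<open>Splitting the exponential criterion at a stage\<close>

definition law_until ::
  "('s, 'a) rs_cmdp \<Rightarrow> ('s, 'a) policy \<Rightarrow> 's pmf \<Rightarrow> nat \<Rightarrow> ('s, 'a) traj pmf" where
  "law_until M d \<alpha> t = bind_pmf \<alpha> (\<lambda>x. run M d 1 (t - 1) (start 1 x))"

definition tail_value ::
  "('s, 'a) rs_cmdp \<Rightarrow> ('s, 'a) criterion \<Rightarrow> ('s, 'a) policy \<Rightarrow> nat \<Rightarrow> 's \<Rightarrow> real" where
  "tail_value M m d t x = measure_pmf.expectation (run M d t (horizon M - t) (start t x))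
     (\<lambda>\<omega>. exp (partial_sum m t (horizon M) \<omega> + terminal m (fst \<omega> (horizon M))))"

lemma partial_sum_cong:
  assumes "\<And>k. t \<le> k \<Longrightarrow> k \<le> u \<Longrightarrow> fst \<omega> k = fst \<omega>' k"
    and "\<And>k. t \<le> k \<Longrightarrow> k < u \<Longrightarrow> snd \<omega> k = snd \<omega>' k"
  shows "partial_sum m t u \<omega> = partial_sum m t u \<omega>'"
  using assms unfolding partial_sum_def by (auto simp: split_beta intro!: sum.cong)

lemma partial_sum_append:
  assumes "s \<le> t" "t \<le> u"
  shows "partial_sum m s u \<omega> = partial_sum m s t \<omega> + partial_sum m t u \<omega>"
  using assms unfolding partial_sum_def by (simp add: split_beta sum.atLeastLessThan_concat)

lemma law_eq_bind_law_until:
  assumes "1 \<le> t" "t \<le> horizon M"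
  shows "law M d \<alpha> = bind_pmf (law_until M d \<alpha> t) (run M d t (horizon M - t))"
proof -
  have "run M d 1 (horizon M - 1) \<omega> =
        bind_pmf (run M d 1 (t - 1) \<omega>) (run M d t (horizon M - t))" for \<omega>
    using run_add[of M d 1 "t - 1" "horizon M - t" \<omega>] assms by simp
  then show ?thesis
    by (simp add: law_def law_until_def bind_assoc_pmf)
qed

lemma law_until_cong:
  assumes "\<And>k. k < t \<Longrightarrow> d k = e k"
  shows "law_until M d \<alpha> t = law_until M e \<alpha> t"
  unfolding law_until_def by (intro bind_pmf_cong refl run_cong assms) auto

lemma finite_set_law_until:
  assumes "wf_cmdp M" "d \<in> policies M" "set_pmf \<alpha> \<subseteq> states M 1" "t \<in> {1..<horizon M}"
  shows "finite (set_pmf (law_until M d \<alpha> t)) \<and>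
         (\<forall>\<omega>\<in>set_pmf (law_until M d \<alpha> t). fst \<omega> t \<in> states M t)"
proof -
  have "finite (states M 1)"
    using assms(1,4) unfolding wf_cmdp_def by auto
  then have fin: "finite (set_pmf \<alpha>)"
    using assms(3) by (rule finite_subset[rotated])
  have "finite (set_pmf (run M d 1 (t - 1) (start 1 x))) \<and>
     (\<forall>\<omega>'\<in>set_pmf (run M d 1 (t - 1) (start 1 x)). fst \<omega>' (1 + (t - 1)) \<in> states M (1 + (t - 1)))"
    if "x \<in> set_pmf \<alpha>" for x
    by (rule finite_set_run) (use assms that in \<open>auto simp: start_def\<close>)
  then show ?thesis
    using fin assms(4) by (auto simp: law_until_def)
qed

lemma forward_factor_eq_law_until:
  assumes "t \<in> {1..<horizon M}"
  shows "forward_factor M m \<alpha> d t x = measure_pmf.expectation (law_until M d \<alpha> t)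
     (\<lambda>\<omega>. exp (partial_sum m 1 t \<omega>) * of_bool (fst \<omega> t = x))"
    (is "_ = measure_pmf.expectation _ ?g")
proof -
  have "map_pmf ?g (run M d t (horizon M - t) \<omega>) = map_pmf (\<lambda>_. ?g \<omega>) (run M d t (horizon M - t) \<omega>)"
    for \<omega>
  proof (rule map_pmf_cong[OF refl])
    fix \<omega>' assume "\<omega>' \<in> set_pmf (run M d t (horizon M - t) \<omega>)"
    from run_keeps_past[OF this] have "partial_sum m 1 t \<omega>' = partial_sum m 1 t \<omega>"
      "fst \<omega>' t = fst \<omega> t"
      by (auto intro!: partial_sum_cong)
    then show "?g \<omega>' = ?g \<omega>"
      by simp
  qed
  then have "map_pmf ?g (law M d \<alpha>) = map_pmf ?g (law_until M d \<alpha> t)"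
    using assms by (simp add: law_eq_bind_law_until[of t] map_bind_pmf map_pmf_def[of ?g "law_until M d \<alpha> t"])
  from arg_cong[OF this, of "\<lambda>p. measure_pmf.expectation p (\<lambda>z. z)"] show ?thesis
    by (simp add: forward_factor_def)
qed

lemma forward_factor_cong:
  assumes "t \<in> {1..<horizon M}" "\<And>k. k < t \<Longrightarrow> d k = e k"
  shows "forward_factor M m \<alpha> d t x = forward_factor M m \<alpha> e t x"
  using assms by (simp add: forward_factor_eq_law_until law_until_cong[OF assms(2)])

lemma backward_factor_cong:
  assumes "\<And>k. t < k \<Longrightarrow> d k = e k"
  shows "backward_factor M m d t x a = backward_factor M m e t x a"
proof -
  have "run M d (Suc t) n = run M e (Suc t) n" for n
    by (intro ext run_cong assms) auto
  then show ?thesis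
    by (simp add: backward_factor_def law_from_def)
qed

lemma tail_value_eq_sum_backward_factor:
  assumes "wf_cmdp M" "d \<in> policies M" "t \<in> {1..<horizon M}" "x \<in> states M t"
  shows "tail_value M m d t x = (\<Sum>a\<in>actions M t x. pmf (d t x) a * backward_factor M m d t x a)"
proof -
  have T: "horizon M - t = Suc (horizon M - Suc t)"
    using assms(3) by auto
  have run: "run M d t (horizon M - t) (start t x) = bind_pmf (d t x) (law_from M d t x)"
    unfolding T by (simp add: law_from_def[abs_def] start_def)
  have fin: "finite (set_pmf (law_from M d t x a))" if "a \<in> actions M t x" for a
  proof -
    have mv: "finite (set_pmf (move M t a (start t x))) \<and>
         (\<forall>\<omega>'\<in>set_pmf (move M t a (start t x)). fst \<omega>' (Suc t) \<in> states M (Suc t))"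
      by (rule finite_set_move) (use assms that in \<open>auto simp: start_def\<close>)
    have "finite (set_pmf (run M d (Suc t) (horizon M - Suc t) \<omega>))"
      if "\<omega> \<in> set_pmf (move M t a (start t x))" for \<omega>
      by (rule conjunct1[OF finite_set_run]) (use assms mv that in auto)
    then show ?thesis
      using mv by (auto simp: law_from_def)
  qed
  have "finite (actions M t x)"
    using assms unfolding wf_cmdp_def by auto
  then show ?thesis
    unfolding tail_value_def run backward_factor_def
    using pmf_expectation_bind[where f = "law_from M d t x" and h = "h :: _ \<Rightarrow> real" for h,
        OF _ fin policies_action[OF assms(2-4)]]
    by simp
qed

text \<open>The Markov property: the past contributes the factor that it has already accumulated, and
  the rest of the run may be restarted afresh from the current state.\<close>

lemma expectation_tail:
  assumes "t \<in> {1..<horizon M}"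
  shows "measure_pmf.expectation (run M d t (horizon M - t) \<omega>)
           (\<lambda>\<omega>. exp (partial_sum m 1 (horizon M) \<omega> + terminal m (fst \<omega> (horizon M)))) =
         exp (partial_sum m 1 t \<omega>) * tail_value M m d t (fst \<omega> t)"
proof -
  let ?T = "horizon M" and ?R = "run M d t (horizon M - t)"
  let ?h = "\<lambda>\<omega>. exp (partial_sum m t ?T \<omega> + terminal m (fst \<omega> ?T))"
  have "exp (partial_sum m 1 ?T \<omega>' + terminal m (fst \<omega>' ?T)) = exp (partial_sum m 1 t \<omega>) * ?h \<omega>'"
    if "\<omega>' \<in> set_pmf (?R \<omega>)" for \<omega>'
  proof -
    have "partial_sum m 1 t \<omega>' = partial_sum m 1 t \<omega>"
      using run_keeps_past[OF that] by (auto intro!: partial_sum_cong)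
    then show ?thesis
      using assms by (simp add: partial_sum_append[of 1 t ?T] exp_add)
  qed
  then have "measure_pmf.expectation (?R \<omega>)
           (\<lambda>\<omega>. exp (partial_sum m 1 ?T \<omega> + terminal m (fst \<omega> ?T))) =
        measure_pmf.expectation (?R \<omega>) (\<lambda>\<omega>'. exp (partial_sum m 1 t \<omega>) * ?h \<omega>')"
    by (intro integral_cong_AE) (auto simp: AE_measure_pmf_iff)
  also have "\<dots> = exp (partial_sum m 1 t \<omega>) * measure_pmf.expectation (?R \<omega>) ?h"
    by simp
  also have "map_pmf ?h (?R \<omega>) = map_pmf ?h (?R (start t (fst \<omega> t)))"
  proof (rule map_run_independent_of_past[where s = t])
    fix \<omega>1 \<omega>2 :: "('a, 'b) traj"
    assume "\<And>k. t \<le> k \<Longrightarrow> k \<le> t + (?T - t) \<Longrightarrow> fst \<omega>1 k = fst \<omega>2 k"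
      "\<And>k. t \<le> k \<Longrightarrow> k < t + (?T - t) \<Longrightarrow> snd \<omega>1 k = snd \<omega>2 k"
    then have "partial_sum m t ?T \<omega>1 = partial_sum m t ?T \<omega>2" "fst \<omega>1 ?T = fst \<omega>2 ?T"
      using assms by (auto intro!: partial_sum_cong)
    then show "?h \<omega>1 = ?h \<omega>2"
      by simp
  qed (auto simp: start_def)
  from arg_cong[OF this, of "\<lambda>p. measure_pmf.expectation p (\<lambda>z. z)"]
  have "measure_pmf.expectation (?R \<omega>) ?h = tail_value M m d t (fst \<omega> t)"
    by (simp add: tail_value_def)
  finally show ?thesis .
qed

lemma J_eq_sum_forward_tail:
  assumes "wf_cmdp M" "d \<in> policies M" "set_pmf \<alpha> \<subseteq> states M 1" "t \<in> {1..<horizon M}"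
  shows "J M m \<alpha> d = (\<Sum>x\<in>states M t. forward_factor M m \<alpha> d t x * tail_value M m d t x)"
proof -
  let ?P = "law_until M d \<alpha> t"
  let ?past = "\<lambda>\<omega>. exp (partial_sum m 1 t \<omega>)"
  have X: "fst \<omega> t \<in> states M t" if "\<omega> \<in> set_pmf ?P" for \<omega>
    using finite_set_law_until[OF assms] that by auto
  have finP: "finite (set_pmf ?P)"
    using finite_set_law_until[OF assms] by simp
  have finS: "finite (states M t)"
    using assms unfolding wf_cmdp_def by auto
  have finR: "finite (set_pmf (run M d t (horizon M - t) \<omega>))" if "\<omega> \<in> set_pmf ?P" for \<omega>
    by (rule conjunct1[OF finite_set_run]) (use assms X that in auto)
  have "J M m \<alpha> d = measure_pmf.expectation ?P (\<lambda>\<omega>. ?past \<omega> * tail_value M m d t (fst \<omega> t))"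
    unfolding J_def using assms(4)
    by (simp add: law_eq_bind_law_until[of t] expectation_bind_pmf_finite[OF finP finR]
          expectation_tail)
  also have "\<dots> = measure_pmf.expectation ?P
      (\<lambda>\<omega>. \<Sum>x\<in>states M t. ?past \<omega> * of_bool (fst \<omega> t = x) * tail_value M m d t x)"
  proof (intro integral_cong_AE)
    have "?past \<omega> * tail_value M m d t (fst \<omega> t) =
        (\<Sum>x\<in>states M t. ?past \<omega> * of_bool (fst \<omega> t = x) * tail_value M m d t x)"
      if "\<omega> \<in> set_pmf ?P" for \<omega>
    proof -
      have "(\<Sum>x\<in>states M t. ?past \<omega> * of_bool (fst \<omega> t = x) * tail_value M m d t x) =
          (\<Sum>x\<in>states M t. if fst \<omega> t = x then ?past \<omega> * tail_value M m d t x else 0)"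
        by (intro sum.cong) auto
      then show ?thesis
        using finS X[OF that] by simp
    qed
    then show "AE \<omega> in ?P. ?past \<omega> * tail_value M m d t (fst \<omega> t) =
        (\<Sum>x\<in>states M t. ?past \<omega> * of_bool (fst \<omega> t = x) * tail_value M m d t x)"
      by (simp add: AE_measure_pmf_iff)
  qed auto
  also have "\<dots> = (\<Sum>x\<in>states M t. forward_factor M m \<alpha> d t x * tail_value M m d t x)"
    using finP assms(4)
    by (simp add: integrable_measure_pmf_finite forward_factor_eq_law_until)
  finally show ?thesis .
qed

section \<open>Stage values as values of modified policies\<close>

lemma policies_upd:
  assumes "d \<in> policies M" "d' \<in> policies M" "t \<in> {1..<horizon M}"
  shows "d(t := d' t) \<in> policies M"
proof -
  let ?D = "\<lambda>t. \<Pi>\<^sub>E x\<in>states M t. {q. set_pmf q \<subseteq> actions M t x}"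
  have D: "d \<in> PiE {1..<horizon M} ?D" "d' \<in> PiE {1..<horizon M} ?D"
    using assms(1,2) unfolding policies_def .
  have "d(t := d' t) \<in> PiE (insert t {1..<horizon M}) ?D"
    by (rule PiE_fun_upd[where T = ?D, OF PiE_mem[OF D(2) assms(3)] D(1)])
  then show ?thesis
    unfolding policies_def insert_absorb[OF assms(3)] .
qed

text \<open>Neither the forward nor the backward factors at stage \<open>t\<close> see the decision rule of stage \<open>t\<close>,
  so they may be computed for the modified policy, whose stage value at \<open>t\<close> is its
  criterion split at \<open>t\<close>.\<close>

lemma stage_value_eq_J_upd:
  assumes "wf_cmdp M" "d \<in> policies M" "d' \<in> policies M" "set_pmf \<alpha> \<subseteq> states M 1"
    and t: "t \<in> {1..<horizon M}"
  shows "stage_value M t d' (forward_factor M m \<alpha> d) (backward_factor M m d) =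
         J M m \<alpha> (d(t := d' t))"
proof -
  let ?e = "d(t := d' t)"
  have e: "?e \<in> policies M"
    using assms by (intro policies_upd)
  have ff: "forward_factor M m \<alpha> d t x = forward_factor M m \<alpha> ?e t x" for x
    using t by (rule forward_factor_cong) auto
  have bf: "backward_factor M m d t x a = backward_factor M m ?e t x a" for x a
    by (rule backward_factor_cong) auto
  have "J M m \<alpha> ?e = (\<Sum>x\<in>states M t. forward_factor M m \<alpha> ?e t x *
          (\<Sum>a\<in>actions M t x. pmf (?e t x) a * backward_factor M m ?e t x a))"
    using tail_value_eq_sum_backward_factor[OF assms(1) e t]
    by (simp add: J_eq_sum_forward_tail[OF assms(1) e assms(4) t])
  then show ?thesis
    by (simp add: stage_value_def ff bf sum_distrib_left mult.assoc)
qed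

lemma f_reward_eq_J_upd:
  assumes "wf_cmdp M" "d \<in> policies M" "d' \<in> policies M" "t \<in> {1..<horizon M}"
  shows "f_reward M t d' d = J M (reward M) (init_reward M) (d(t := d' t))"
  unfolding f_reward_def
  by (rule stage_value_eq_J_upd) (use assms in \<open>auto simp: wf_cmdp_def\<close>)

lemma f_cost_eq_J_upd:
  assumes "wf_cmdp M" "d \<in> policies M" "d' \<in> policies M" "t \<in> {1..<horizon M}"
  shows "f_cost M t d' d = J M (cost M) (init_cost M) (d(t := d' t))"
  unfolding f_cost_def
  by (rule stage_value_eq_J_upd) (use assms in \<open>auto simp: wf_cmdp_def\<close>)

section \<open>Equivalence of the three problems\<close>

lemma sum_f_reward_self:
  assumes "wf_cmdp M" "d \<in> policies M"
  shows "(\<Sum>t\<in>{1..<horizon M}. f_reward M t d d) =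
         real (horizon M - 1) * J M (reward M) (init_reward M) d"
  using f_reward_eq_J_upd[OF assms(1,2,2)] by simp

lemma f_cost_self_le_iff:
  assumes "wf_cmdp M" "d \<in> policies M"
  shows "(\<forall>t\<in>{1..<horizon M}. f_cost M t d d \<le> budget M) \<longleftrightarrow>
         J M (cost M) (init_cost M) d \<le> budget M"
proof -
  \<comment> \<open>There is at least one stage, so the stagewise constraints are not vacuous.\<close>
  have "1 \<in> {1..<horizon M}"
    using assms(1) by (auto simp: wf_cmdp_def)
  then show ?thesis
    using f_cost_eq_J_upd[OF assms(1,2,2)] by auto
qed

text \<open>Changing a single decision rule of an optimal policy without violating the budget cannot
  increase the reward, and the linear program only compares sums of such one-stage changes.\<close>

lemma solutions_P_subset_fixed_points:
  assumes "wf_cmdp M"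
  shows "solutions_P M \<subseteq> fixed_points M"
proof
  fix d assume "d \<in> solutions_P M"
  then have d: "d \<in> policies M" and cost: "J M (cost M) (init_cost M) d \<le> budget M"
    and opt: "\<And>e. e \<in> policies M \<Longrightarrow> J M (cost M) (init_cost M) e \<le> budget M \<Longrightarrow>
      J M (reward M) (init_reward M) e \<le> J M (reward M) (init_reward M) d"
    by (auto simp: solutions_P_def is_arg_max_linorder)
  have "(\<Sum>t\<in>{1..<horizon M}. f_reward M t e d) \<le> (\<Sum>t\<in>{1..<horizon M}. f_reward M t d d)"
    if e: "e \<in> policies M" and "\<forall>t\<in>{1..<horizon M}. f_cost M t e d \<le> budget M" for e
  proof (rule sum_mono)
    fix t assume t: "t \<in> {1..<horizon M}"
    show "f_reward M t e d \<le> f_reward M t d d"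
      using opt[OF policies_upd[OF d e t]] that t
      by (simp add: f_reward_eq_J_upd f_cost_eq_J_upd assms d)
  qed
  then show "d \<in> fixed_points M"
    using d cost f_cost_self_le_iff[OF assms d]
    by (simp add: fixed_points_def solutions_LP_def is_arg_max_linorder)
qed

lemma fixed_points_feasible:
  assumes "wf_cmdp M" "d \<in> fixed_points M"
  shows "d \<in> policies M \<and> J M (cost M) (init_cost M) d \<le> budget M"
  using assms f_cost_self_le_iff[OF assms(1)]
  by (auto simp: fixed_points_def solutions_LP_def is_arg_max_linorder)

text \<open>Existence of a maximizer over \<open>P\<close> matters: it lies in \<open>R\<close>, so a maximizer over \<open>R\<close> must reach its
  value. Without it, \<open>R\<close> could have maximizers of its own that are not optimal in \<open>P\<close>.\<close>

lemma is_arg_max_sandwich: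
  fixes f g :: "'p \<Rightarrow> real"
  assumes "{x. is_arg_max f P x} \<noteq> {}"
    and sol: "\<And>x. is_arg_max f P x \<Longrightarrow> R x"
    and sub: "\<And>x. R x \<Longrightarrow> P x"
    and g: "\<And>x. P x \<Longrightarrow> g x = c * f x" and c: "0 < c"
  shows "{x. is_arg_max f P x} = {x. is_arg_max g R x}"
proof -
  obtain s where s: "is_arg_max f P s"
    using assms(1) by blast
  have le: "g x \<le> g y \<longleftrightarrow> f x \<le> f y" if "P x" "P y" for x y
    using g[OF that(1)] g[OF that(2)] c by simp
  show ?thesis
    using s sol sub le unfolding is_arg_max_linorder by (blast intro: order_trans)
qed

theorem theorem2:
  fixes M :: "('s, 'a) rs_cmdp"
  assumes "wf_cmdp M"
    and "solutions_P M \<noteq> {}"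
  shows "solutions_P M = solutions_GF M \<and> solutions_P M = solutions_GO M"
proof
  have pos: "0 < real (horizon M - 1)"
    using assms(1) by (auto simp: wf_cmdp_def)
  show "solutions_P M = solutions_GF M"
    unfolding solutions_P_def solutions_GF_def
  proof (rule is_arg_max_sandwich[OF _ _ _ _ pos])
    show "d \<in> fixed_points M"
      if "is_arg_max (J M (reward M) (init_reward M))
        (\<lambda>e. e \<in> policies M \<and> J M (cost M) (init_cost M) e \<le> budget M) d" for d
      using solutions_P_subset_fixed_points[OF assms(1)] that by (auto simp: solutions_P_def)
  qed (use assms in \<open>auto simp: solutions_P_def sum_f_reward_self dest: fixed_points_feasible\<close>)
  show "solutions_P M = solutions_GO M"
    unfolding solutions_P_def solutions_GO_def
    by (rule is_arg_max_sandwich[OF _ _ _ _ pos])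
       (use assms in \<open>auto simp: solutions_P_def sum_f_reward_self f_cost_self_le_iff is_arg_max_linorder\<close>)
qed

end
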